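(* For every integer $n\ge 1$, $$\sum_{\sigma\in\mathcal{Q}_n}x^{\mathrm{ap}(\sigma)}=\sum_{\sigma\in\mathcal{Q}_n}x^{\mathrm{ud}(\sigma)},\qquad \sum_{\sigma\in\mathcal{Q}_n}x^{\mathrm{lap}(\sigma)}=\sum_{\sigma\in\mathcal{Q}_n}x^{\mathrm{eud}(\sigma)}.$$
   Context: $\mathcal{Q}_n$ is the set of Stirling permutations of order $n$: words $\sigma=\sigma_1\sigma_2\cdots\sigma_{2n}$ that are arrangements of the multiset $\{1,1,2,2,\ldots,n,n\}$ such that whenever $i<s<j$ and $\sigma_i=\sigma_j$ one has $\sigma_s\ge\sigma_i$. For $\sigma\in\mathcal{Q}_n$: - $\mathrm{ap}(\sigma)$ (ascent-plateaux) is the number of $i\in\{2,3,\ldots,2n-1\}$ with $\sigma_{i-1}<\sigma_i=\sigma_{i+1}$. - $\mathrm{lap}(\sigma)$ (left ascent-plateaux) is the number of $i\in\{1,2,\ldots,2n-1\}$ with $\sigma_{i-1}<\sigma_i=\sigma_{i+1}$, where $\sigma_0=0$. - An entry $\sigma_i$ is an up-down-pair entry if $\sigma_{i-1}<\sigma_i=\sigma_j>\sigma_{j+1}$ for some $j>i$ (the two equal entries $\sigma_i,\sigma_j$ may be arbitrarily far apart). - $\mathrm{ud}(\sigma)$ is the number of $i\in\{1,\ldots,2n-2\}$ such that $\sigma_i$ is an up-down-pair entry, where $\sigma_0=0$ but no entry $\sigma_{2n+1}$ is appended (so $j\le 2n-1$ is required). - $\mathrm{eud}(\sigma)$ is the number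 of $i\in\{1,\ldots,2n-1\}$ such that $\sigma_i$ is an up-down-pair entry, where $\sigma_0=\sigma_{2n+1}=0$. For example, $\mathrm{ud}(123321)=2$ and $\mathrm{eud}(123321)=3$, while $\mathrm{ud}(331221)=\mathrm{eud}(331221)=2$. *)

theory Defs
  imports "HOL-Library.Multiset" "HOL-Computational_Algebra.Polynomial"
begin

text \<open>Words are lists, but positions are counted from 1. Reading a word outside of
  the positions \<open>1, \<dots>, length \<sigma>\<close> gives 0, so that \<open>letter \<sigma> 0\<close> and
  \<open>letter \<sigma> (length \<sigma> + 1)\<close> are the boundary letters 0; the index ranges
  below determine whether a statistic ever reads them.\<close>

definition letter :: "nat list \<Rightarrow> nat \<Rightarrow> nat" where
  "letter \<sigma> i = (if 1 \<le> i \<and> i \<le> length \<sigma> then \<sigma> ! (i - 1) else 0)"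

definition stirling_perms :: "nat \<Rightarrow> nat list set" where
  "stirling_perms n =
    {\<sigma>. mset \<sigma> = (\<Sum>k\<in>{1..n}. {#k, k#}) \<and>
        (\<forall>i s j. 1 \<le> i \<and> i < s \<and> s < j \<and> j \<le> length \<sigma> \<and> letter \<sigma> i = letter \<sigma> j
           \<longrightarrow> letter \<sigma> s \<ge> letter \<sigma> i)}"

lemma length_stirling_perms:
  assumes "\<sigma> \<in> stirling_perms n"
  shows "length \<sigma> = 2 * n"
proof -
  have "length \<sigma> = size (\<Sum>k\<in>{1..n}. {#k, k#})"
    using assms unfolding stirling_perms_def by (metis (mono_tags, lifting) mem_Collect_eq size_mset)
  also have "\<dots> = 2 * n" by simp
  finally show ?thesis .
qed

lemma finite_stirling_perms: "finite (stirling_perms n)"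
proof (rule finite_subset)
  show "stirling_perms n \<subseteq> {\<sigma>. set \<sigma> \<subseteq> {1..n} \<and> length \<sigma> = 2 * n}"
  proof
    fix \<sigma> assume \<sigma>: "\<sigma> \<in> stirling_perms n"
    then have "set_mset (mset \<sigma>) = set_mset (\<Sum>k\<in>{1..n}. {#k, k#})"
      unfolding stirling_perms_def by simp
    also have "\<dots> = {1..n}" by (simp add: set_mset_sum)
    finally show "\<sigma> \<in> {\<sigma>. set \<sigma> \<subseteq> {1..n} \<and> length \<sigma> = 2 * n}"
      using length_stirling_perms[OF \<sigma>] by simp
  qed
  show "finite {\<sigma>. set \<sigma> \<subseteq> {1..n} \<and> length \<sigma> = 2 * n}"
    by (rule finite_lists_length_eq) simp
qed

text \<open>In the following, \<open>length \<sigma>\<close> stands for \<open>2 n\<close>.\<close>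

definition ap :: "nat list \<Rightarrow> nat" where
  "ap \<sigma> = card {i \<in> {2..length \<sigma> - 1}.
     letter \<sigma> (i - 1) < letter \<sigma> i \<and> letter \<sigma> i = letter \<sigma> (i + 1)}"

definition lap :: "nat list \<Rightarrow> nat" where
  "lap \<sigma> = card {i \<in> {1..length \<sigma> - 1}.
     letter \<sigma> (i - 1) < letter \<sigma> i \<and> letter \<sigma> i = letter \<sigma> (i + 1)}"

text \<open>The bound \<open>m\<close> is the last position allowed for the second of the two equal
  entries: \<open>2 n - 1\<close> if no entry is appended to the word, and \<open>2 n\<close> if
  a final 0 is appended.\<close>

definition up_down_pair_entry :: "nat list \<Rightarrow> nat \<Rightarrow> nat \<Rightarrow> bool" where
  "up_down_pair_entry \<sigma> m i \<longleftrightarrow>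
     (\<exists>j. i < j \<and> j \<le> m \<and> letter \<sigma> (i - 1) < letter \<sigma> i \<and>
          letter \<sigma> i = letter \<sigma> j \<and> letter \<sigma> j > letter \<sigma> (j + 1))"

definition ud :: "nat list \<Rightarrow> nat" where
  "ud \<sigma> = card {i \<in> {1..length \<sigma> - 2}. up_down_pair_entry \<sigma> (length \<sigma> - 1) i}"

definition eud :: "nat list \<Rightarrow> nat" where
  "eud \<sigma> = card {i \<in> {1..length \<sigma> - 1}. up_down_pair_entry \<sigma> (length \<sigma>) i}"

end

theory Submission
  imports Defs
begin

text \<open>Every Stirling permutation of order \<open>n + 1\<close> arises exactly once by inserting the
  adjacent pair \<open>n + 1, n + 1\<close> into one of the \<open>2 n + 1\<close> gaps of a Stirling permutation of
  order \<open>n\<close>: nothing smaller may stand between the two copies of the largest letter.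

  Each of the four statistics counts objects that sit on two gaps of the word.
  An ascent-plateau \<open>u < v = v\<close> sits on the gap before its first \<open>v\<close> and on the gap between
  the two copies of \<open>v\<close>; an up-down-pair sits on the gap before its first entry and on
  the gap after its second one. No gap carries two objects. Inserting a pair of new largest
  letters into a gap destroys the object on that gap, leaves the others alone, creates none among
  the old letters, and the new pair itself is a new object. Hence, for \<open>lap\<close> and \<open>eud\<close>, a word
  of value \<open>k\<close> has \<open>2 k\<close> gaps where insertion keeps the value \<open>k\<close>, and insertion
  into any other gap gives \<open>k + 1\<close>.

  For \<open>ap\<close> the objects on the leftmost gap are discarded, for \<open>ud\<close> those on the
  rightmost gap. Insertion into that boundary gap creates nothing that counts and destroys nothing
  that counts, so now \<open>2 k + 1\<close> gaps keep the value \<open>k\<close>. Two statistics with the same number of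
  value-keeping gaps have distributions satisfying the same recurrence in \<open>n\<close>, so they are
  equidistributed.\<close>

section \<open>Inserting the largest pair\<close>

definition insert_pair :: "nat \<Rightarrow> nat \<Rightarrow> nat list \<Rightarrow> nat list" where
  "insert_pair m g \<sigma> = take g \<sigma> @ m # m # drop g \<sigma>"

text \<open>Gap \<open>g\<close> lies between the positions \<open>g\<close> and \<open>g + 1\<close>; \<open>shift g\<close> is the effect
  of an insertion there on the old positions, the boundary positions included. On gaps other than
  \<open>g\<close> it is the effect on the gaps as well.\<close>

definition shift :: "nat \<Rightarrow> nat \<Rightarrow> nat" where
  "shift g k = (if k \<le> g then k else Suc (Suc k))"

lemma shift_less_iff [simp]: "shift g i < shift g j \<longleftrightarrow> i < j"
  by (auto simp: shift_def)

lemma shift_eq_iff [simp]: "shift g i = shift g j \<longleftrightarrow> i = j"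
  by (auto simp: shift_def split: if_splits)

lemma shift_Suc: "i \<noteq> g \<Longrightarrow> shift g (Suc i) = Suc (shift g i)"
  by (auto simp: shift_def)

lemma position_cases:
  obtains (old) k where "i = shift g k" | (first) "i = Suc g" | (second) "i = Suc (Suc g)"
proof -
  consider "i \<le> g" | "i = Suc g" | "i = Suc (Suc g)" | "i > Suc (Suc g)"
    by linarith
  then show ?thesis
  proof cases
    case 1
    then show ?thesis using old[of i] by (simp add: shift_def)
  next
    case 4
    then have "i = shift g (i - 2)" by (auto simp: shift_def)
    then show ?thesis by (rule old)
  qed (use first second in auto)
qed

lemma letter_0 [simp]: "letter \<sigma> 0 = 0"
  by (simp add: letter_def)

lemma letter_pos_imp_le_length: "0 < letter \<sigma> i \<Longrightarrow> i \<le> length \<sigma>"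
  by (auto simp: letter_def split: if_splits)

lemma letter_in_set: "1 \<le> i \<Longrightarrow> i \<le> length \<sigma> \<Longrightarrow> letter \<sigma> i \<in> set \<sigma>"
  by (auto simp: letter_def)

lemma length_insert_pair [simp]:
  "g \<le> length \<sigma> \<Longrightarrow> length (insert_pair m g \<sigma>) = Suc (Suc (length \<sigma>))"
  by (simp add: insert_pair_def)

lemma letter_insert_pair_old:
  "g \<le> length \<sigma> \<Longrightarrow> letter (insert_pair m g \<sigma>) (shift g k) = letter \<sigma> k"
proof (cases "k \<le> g")
  case False
  moreover assume "g \<le> length \<sigma>"
  moreover from False obtain d where "k = Suc (g + d)"
    using less_iff_Suc_add[of g k] by auto
  ultimately show ?thesis
    by (auto simp: letter_def insert_pair_def shift_def nth_append)
qed (auto simp: letter_def insert_pair_def shift_def nth_append)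

lemma letter_insert_pair_new:
  "g \<le> length \<sigma> \<Longrightarrow> letter (insert_pair m g \<sigma>) (Suc g) = m"
  "g \<le> length \<sigma> \<Longrightarrow> letter (insert_pair m g \<sigma>) (Suc (Suc g)) = m"
  by (auto simp: letter_def insert_pair_def nth_append)

lemma letter_insert_pair_le:
  assumes "g \<le> length \<sigma>" "\<And>k. letter \<sigma> k \<le> m"
  shows "letter (insert_pair m g \<sigma>) i \<le> m"
  using assms letter_insert_pair_old[OF assms(1)] letter_insert_pair_new[OF assms(1)]
  by (cases i rule: position_cases[of _ g]) auto

lemma mset_insert_pair [simp]: "mset (insert_pair m g \<sigma>) = mset \<sigma> + {#m, m#}"
proof -
  have "mset (take g \<sigma>) + mset (drop g \<sigma>) = mset \<sigma>"
    by (metis append_take_drop_id mset_append)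
  then show ?thesis
    by (simp add: insert_pair_def)
qed

text \<open>The new letter is absent from the old word, so its first occurrence reveals the gap.\<close>

lemma insert_pair_inject:
  assumes "m \<notin> set \<sigma>" "m \<notin> set \<tau>" "g \<le> length \<sigma>" "h \<le> length \<tau>"
    and eq: "insert_pair m g \<sigma> = insert_pair m h \<tau>"
  shows "\<sigma> = \<tau> \<and> g = h"
proof -
  have tw: "takeWhile (\<lambda>x. x \<noteq> m) (insert_pair m k \<rho>) = take k \<rho>" if "m \<notin> set \<rho>" for k \<rho>
    unfolding insert_pair_def
    by (subst takeWhile_append2) (use that in \<open>auto dest: in_set_takeD\<close>)
  have t: "take g \<sigma> = take h \<tau>"
    using tw[of \<sigma> g] tw[of \<tau> h] assms by simp
  moreover from t have "drop g \<sigma> = drop h \<tau>"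
    using eq by (simp add: insert_pair_def)
  moreover from t have "g = h"
    using assms by (metis length_take min.absorb2)
  ultimately show ?thesis
    by (metis append_take_drop_id)
qed

section \<open>Stirling permutations grow by insertion\<close>

lemma set_eq_if_mset_eq_pairs:
  fixes n :: nat
  assumes "mset \<sigma> = (\<Sum>k\<in>{1..n}. {#k, k#})"
  shows "set \<sigma> = {1..n}"
proof -
  have "set_mset (mset \<sigma>) = {1..n}"
    unfolding assms by (simp add: set_mset_sum)
  then show ?thesis by simp
qed

lemma set_stirling_perm: "\<sigma> \<in> stirling_perms n \<Longrightarrow> set \<sigma> = {1..n}"
  by (rule set_eq_if_mset_eq_pairs) (simp add: stirling_perms_def)

lemma letter_stirling_perm_le: "\<sigma> \<in> stirling_perms n \<Longrightarrow> letter \<sigma> i \<le> n"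
  using set_stirling_perm[of \<sigma> n] letter_in_set[of i \<sigma>] by (auto simp: letter_def)

lemma stirling_perms_0: "stirling_perms 0 = {[]}"
  by (auto simp: stirling_perms_def)

lemma stirling_permD:
  assumes "\<sigma> \<in> stirling_perms n" "1 \<le> i" "i < s" "s < j" "j \<le> length \<sigma>" "letter \<sigma> i = letter \<sigma> j"
  shows "letter \<sigma> i \<le> letter \<sigma> s"
  using assms unfolding stirling_perms_def by blast

lemma no_three_equal_letters:
  assumes \<sigma>: "\<sigma> \<in> stirling_perms n" and pos: "0 < letter \<sigma> i"
    and eq: "letter \<sigma> j = letter \<sigma> i" "letter \<sigma> k = letter \<sigma> i" and "i \<noteq> j" "i \<noteq> k"
  shows "j = k"
proof (rule ccontr)
  assume "j \<noteq> k"
  let ?v = "letter \<sigma> i"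
  have range: "1 \<le> l \<and> l \<le> length \<sigma> \<and> \<sigma> ! (l - 1) = ?v" if "letter \<sigma> l = ?v" for l
    using that pos by (auto simp: letter_def split: if_splits)
  have "card {i - 1, j - 1, k - 1} = 3"
    using range[of i] range[of j] range[of k] eq assms(5,6) \<open>j \<noteq> k\<close> by (simp add: eq_diff_iff)
  moreover have "{i - 1, j - 1, k - 1} \<subseteq> {p. p < length \<sigma> \<and> \<sigma> ! p = ?v}"
    using range[of i] range[of j] range[of k] eq by (auto simp: less_eq_Suc_le)
  ultimately have "3 \<le> card {p. p < length \<sigma> \<and> \<sigma> ! p = ?v}"
    by (metis (no_types, lifting) card_mono finite_nat_set_iff_bounded mem_Collect_eq)
  also have "\<dots> = count (mset \<sigma>) ?v"
  proof -
    have "count (mset \<sigma>) ?v = length (filter ((=) ?v) \<sigma>)"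
      unfolding replicate_count_mset_eq_filter_eq[symmetric] by simp
    then show ?thesis
      by (simp only: length_filter_conv_card eq_commute)
  qed
  also have "\<dots> = (\<Sum>k\<in>{1..n}. if k = ?v then 2 else 0)"
  proof -
    have "mset \<sigma> = (\<Sum>k\<in>{1..n}. {#k, k#})"
      using \<sigma> by (simp add: stirling_perms_def)
    then show ?thesis
      by (simp only: count_sum) (rule sum.cong, auto)
  qed
  also have "\<dots> \<le> 2"
    by simp
  finally show False by simp
qed

text \<open>The new letters may stand between any two equal letters, being larger, and nothing stands between
  the new letters themselves.\<close>

lemma insert_pair_in_stirling_perms:
  assumes \<sigma>: "\<sigma> \<in> stirling_perms n" and g: "g \<le> length \<sigma>"
  shows "insert_pair (Suc n) g \<sigma> \<in> stirling_perms (Suc n)"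
proof -
  let ?\<tau> = "insert_pair (Suc n) g \<sigma>"
  note letter_old = letter_insert_pair_old[OF g] and new = letter_insert_pair_new[OF g]
  have "letter ?\<tau> i \<le> letter ?\<tau> s"
    if i: "1 \<le> i" "i < s" and s: "s < j" and j: "j \<le> length ?\<tau>" and eq: "letter ?\<tau> i = letter ?\<tau> j"
    for i s j
  proof (cases s rule: position_cases[of _ g])
    case (old s')
    have small: "letter \<sigma> k < Suc n" for k
      using letter_stirling_perm_le[OF \<sigma>, of k] by simp
    \<comment> \<open>Two equal letters around an old letter are old: a copy of the new letter equals only the adjacent copy.\<close>
    have "\<exists>i' j'. i = shift g i' \<and> j = shift g j'"
      by (cases i rule: position_cases[of _ g]; cases j rule: position_cases[of _ g])
         (use i s eq small old in \<open>auto simp: letter_old new dest: less_not_sym\<close>,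
          (use small[THEN less_imp_neq] in metis)+)
    then obtain i' j' where ij: "i = shift g i'" "j = shift g j'"
      by blast
    have "1 \<le> i'" using i ij by (cases i') (auto simp: shift_def)
    moreover have "j' \<le> length \<sigma>"
      using j g ij by (auto simp: shift_def split: if_splits)
    ultimately have "letter \<sigma> i' \<le> letter \<sigma> s'"
      using \<sigma> i s eq unfolding ij old letter_old stirling_perms_def by auto
    then show ?thesis
      by (simp add: ij old letter_old)
  qed (use new letter_insert_pair_le[OF g, of "Suc n" i] letter_stirling_perm_le[OF \<sigma>] in
      \<open>auto intro: le_SucI\<close>)
  moreover have "mset ?\<tau> = (\<Sum>k\<in>{1..Suc n}. {#k, k#})"
    using \<sigma> by (simp add: stirling_perms_def)
  ultimately show ?thesis
    unfolding stirling_perms_def by blast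
qed

text \<open>Letters between the two copies of the largest letter would have to be at least as large,
  so the copies are adjacent and can be removed together.\<close>

lemma stirling_perms_SucE:
  assumes \<tau>: "\<tau> \<in> stirling_perms (Suc n)"
  obtains \<sigma> g where "\<sigma> \<in> stirling_perms n" "g \<le> 2 * n" "\<tau> = insert_pair (Suc n) g \<sigma>"
proof -
  let ?m = "Suc n"
  have ms: "mset \<tau> = (\<Sum>k\<in>{1..n}. {#k, k#}) + {#?m, ?m#}"
    using \<tau> by (simp add: stirling_perms_def)
  then have "?m \<in> set \<tau>"
    by (metis add_mset_add_single set_mset_mset union_iff union_single_eq_member)
  then obtain as ds where 1: "\<tau> = as @ ?m # ds"
    by (meson split_list)
  then have "mset (as @ ds) = (\<Sum>k\<in>{1..n}. {#k, k#}) + {#?m#}"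
    using ms by simp
  then have ms2: "?m \<in> set as \<or> ?m \<in> set ds"
    by (metis set_append Un_iff set_mset_mset union_iff union_single_eq_member add.commute
        add_mset_add_single)
  have "\<exists>as bs cs. \<tau> = as @ ?m # bs @ ?m # cs"
    using ms2
  proof
    assume "?m \<in> set as"
    then show ?thesis using 1 by (fastforce dest: split_list)
  next
    assume "?m \<in> set ds"
    then show ?thesis using 1 by (fastforce dest: split_list)
  qed
  then obtain as bs cs where \<tau>_eq: "\<tau> = as @ ?m # bs @ ?m # cs"
    by blast
  have rest: "mset (as @ bs @ cs) = (\<Sum>k\<in>{1..n}. {#k, k#})"
    using ms by (simp add: \<tau>_eq)
  then have set_rest: "set (as @ bs @ cs) = {1..n}"
    by (rule set_eq_if_mset_eq_pairs)
  have "bs = []"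
  proof (rule ccontr)
    assume "bs \<noteq> []"
    then obtain b bs' where b: "bs = b # bs'" by (cases bs) auto
    have "letter \<tau> (length as + 1) \<le> letter \<tau> (length as + 2)"
      by (rule stirling_permD[OF \<tau>, where j = "length as + length bs + 2"])
        (simp_all add: \<tau>_eq b letter_def nth_append)
    then have "?m \<le> b"
      by (simp add: \<tau>_eq b letter_def nth_append)
    moreover have "b \<le> n"
      using set_rest b by auto
    ultimately show False by simp
  qed
  let ?g = "length as" and ?\<sigma> = "as @ cs"
  have \<tau>_ins: "\<tau> = insert_pair ?m ?g ?\<sigma>"
    by (simp add: \<tau>_eq \<open>bs = []\<close> insert_pair_def)
  have g: "?g \<le> length ?\<sigma>" by simp
  have "letter ?\<sigma> i \<le> letter ?\<sigma> s"
    if "1 \<le> i" "i < s" "s < j" "j \<le> length ?\<sigma>" "letter ?\<sigma> i = letter ?\<sigma> j" for i s j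
  proof -
    have "1 \<le> shift ?g i" "shift ?g j \<le> length \<tau>"
      using that g by (auto simp: shift_def \<tau>_ins)
    moreover have "letter \<tau> (shift ?g k) = letter ?\<sigma> k" for k
      unfolding \<tau>_ins by (rule letter_insert_pair_old[OF g])
    ultimately show ?thesis
      using stirling_permD[OF \<tau>, of "shift ?g i" "shift ?g s" "shift ?g j"] that by simp
  qed
  then have "?\<sigma> \<in> stirling_perms n"
    using rest unfolding stirling_perms_def \<open>bs = []\<close> append_Nil by blast
  moreover from length_stirling_perms[OF this] g have "?g \<le> 2 * n"
    by simp
  ultimately show ?thesis
    using \<tau>_ins by (rule that)
qed

lemma bij_betw_insert_pair:
  "bij_betw (\<lambda>(\<sigma>, g). insert_pair (Suc n) g \<sigma>) (stirling_perms n \<times> {..2 * n}) (stirling_perms (Suc n))"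
  unfolding bij_betw_def
proof
  have "Suc n \<notin> set \<sigma>" if "\<sigma> \<in> stirling_perms n" for \<sigma>
    using set_stirling_perm[OF that] by simp
  then show "inj_on (\<lambda>(\<sigma>, g). insert_pair (Suc n) g \<sigma>) (stirling_perms n \<times> {..2 * n})"
    by (auto simp: inj_on_def length_stirling_perms dest!: insert_pair_inject[rotated 4])
next
  show "(\<lambda>(\<sigma>, g). insert_pair (Suc n) g \<sigma>) ` (stirling_perms n \<times> {..2 * n}) = stirling_perms (Suc n)"
    by (force simp: length_stirling_perms intro: insert_pair_in_stirling_perms
        elim: stirling_perms_SucE)
qed

section \<open>Statistics with the same insertion law\<close>

definition insertion_law :: "nat \<Rightarrow> (nat list \<Rightarrow> nat) \<Rightarrow> bool" where
  "insertion_law c f \<longleftrightarrow> f [] = 0 \<and>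
     (\<forall>n. \<forall>\<sigma>\<in>stirling_perms n. \<exists>D\<subseteq>{..2 * n}. card D = 2 * f \<sigma> + c \<and>
        (\<forall>g\<le>2 * n. f (insert_pair (Suc n) g \<sigma>) = (if g \<in> D then f \<sigma> else Suc (f \<sigma>))))"

text \<open>The weight \<open>h\<close> is arbitrary so that the induction can absorb one insertion into a new
  weight: summing \<open>h\<close> over all gaps of a word of value \<open>k\<close> gives a number that depends on \<open>k\<close>
  (and \<open>n\<close>, \<open>c\<close>) only.\<close>

lemma insertion_law_equidistributed:
  fixes h :: "nat \<Rightarrow> 'a :: comm_semiring_1"
  assumes f: "insertion_law c f" and f': "insertion_law c f'"
  shows "(\<Sum>\<sigma>\<in>stirling_perms n. h (f \<sigma>)) = (\<Sum>\<sigma>\<in>stirling_perms n. h (f' \<sigma>))"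
proof (induction n arbitrary: h)
  case 0
  then show ?case
    using f f' by (simp add: stirling_perms_0 insertion_law_def)
next
  case (Suc n)
  \<comment> \<open>The sum of \<open>h\<close> over the insertions into a word of value \<open>k\<close>, which has \<open>2 k + c\<close> value-keeping gaps.\<close>
  define H where
    "H k = of_nat (2 * k + c) * h k + of_nat (Suc (2 * n) - (2 * k + c)) * h (Suc k)" for k
  have step: "(\<Sum>\<tau>\<in>stirling_perms (Suc n). h (e \<tau>)) = (\<Sum>\<sigma>\<in>stirling_perms n. H (e \<sigma>))"
    if e: "insertion_law c e" for e
  proof -
    have "(\<Sum>g\<in>{..2 * n}. h (e (insert_pair (Suc n) g \<sigma>))) = H (e \<sigma>)"
      if \<sigma>: "\<sigma> \<in> stirling_perms n" for \<sigma>
    proof -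
      obtain D where D: "D \<subseteq> {..2 * n}" "card D = 2 * e \<sigma> + c"
        "\<And>g. g \<le> 2 * n \<Longrightarrow> e (insert_pair (Suc n) g \<sigma>) = (if g \<in> D then e \<sigma> else Suc (e \<sigma>))"
        using e \<sigma> unfolding insertion_law_def by blast
      have fin: "finite D" using D(1) finite_subset by blast
      have "(\<Sum>g\<in>{..2 * n}. h (e (insert_pair (Suc n) g \<sigma>))) =
          (\<Sum>g\<in>{..2 * n}. if g \<in> D then h (e \<sigma>) else h (Suc (e \<sigma>)))"
        by (rule sum.cong) (auto simp: D(3))
      also have "\<dots> = (\<Sum>g\<in>D. h (e \<sigma>)) + (\<Sum>g\<in>{..2 * n} - D. h (Suc (e \<sigma>)))"
        using D(1) by (simp add: sum.If_cases Int_absorb1 Diff_eq)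
      also have "\<dots> = H (e \<sigma>)"
        using D(1) fin by (simp add: H_def D(2) card_Diff_subset)
      finally show ?thesis .
    qed
    then show ?thesis
      by (simp add: sum.reindex_bij_betw[OF bij_betw_insert_pair, symmetric] case_prod_unfold
          sum.cartesian_product'[where g = "\<lambda>p. h (e (insert_pair (Suc n) (snd p) (fst p)))"])
  qed
  show ?case
    unfolding step[OF f] step[OF f'] by (rule Suc.IH)
qed

section \<open>Objects that sit on two gaps\<close>

text \<open>Distinctness of the gaps makes each insertion destroy at most one object, and makes
  the number of occupied gaps twice the number of objects.\<close>

definition disjoint_pairs :: "(nat \<times> nat) set \<Rightarrow> bool" where
  "disjoint_pairs P \<longleftrightarrow> inj_on fst P \<and> inj_on snd P \<and> fst ` P \<inter> snd ` P = {}"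

definition pairs_avoiding :: "nat set \<Rightarrow> (nat \<times> nat) set \<Rightarrow> (nat \<times> nat) set" where
  "pairs_avoiding Z P = {(a, b) \<in> P. a \<notin> Z \<and> b \<notin> Z}"

text \<open>The set \<open>Z\<close> contains the gaps whose objects are discarded before the insertion, \<open>Z'\<close>
  those discarded afterwards. If \<open>g\<close> is such a gap, the new object \<open>(g, e)\<close> is discarded and
  no counted object sat on \<open>g\<close>; if a counted object sits on \<open>g\<close>, the new object
  compensates for its loss; otherwise there is one object more.\<close>

lemma card_pairs_after_insertion:
  assumes fin: "finite P" and disj: "disjoint_pairs P"
    and P': "P' = insert (g, e) (map_prod (shift g) (shift g) ` pairs_avoiding {g} P)"
    and new: "g \<in> Z' \<or> e \<in> Z' \<longleftrightarrow> g \<in> Z"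
    and old: "\<And>a b k. (a, b) \<in> P \<Longrightarrow> k \<in> {a, b} \<Longrightarrow> k \<noteq> g \<Longrightarrow> shift g k \<in> Z' \<longleftrightarrow> k \<in> Z"
    and Q: "Q = pairs_avoiding Z P"
  shows "card (pairs_avoiding Z' P') =
    (if g \<in> Z \<union> fst ` Q \<union> snd ` Q then card Q else Suc (card Q))"
proof -
  let ?s = "map_prod (shift g) (shift g)" and ?N = "if g \<in> Z then {} else {(g, e)}"
  have eq: "pairs_avoiding Z' P' = ?N \<union> ?s ` pairs_avoiding {g} Q"
    using new old by (auto simp: P' Q pairs_avoiding_def image_iff)
  have notin: "(g, e) \<notin> ?s ` pairs_avoiding {g} Q"
    by (auto simp: pairs_avoiding_def shift_def split: if_splits)
  have finQ: "finite Q"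
    using fin by (auto simp: Q pairs_avoiding_def intro: finite_subset[of _ P])
  have fin': "finite (pairs_avoiding {g} Q)"
    using finQ by (auto simp: pairs_avoiding_def intro: finite_subset[of _ Q])
  have "inj ?s"
    by (auto simp: inj_on_def)
  then have "card (?s ` pairs_avoiding {g} Q) = card (pairs_avoiding {g} Q)"
    by (meson card_image inj_on_subset subset_UNIV)
  then have card: "card (pairs_avoiding Z' P') =
      (if g \<in> Z then 0 else 1) + card (pairs_avoiding {g} Q)"
    using notin fin' by (simp add: eq)
  show ?thesis
  proof (cases "g \<in> fst ` Q \<union> snd ` Q")
    case True
    then obtain p where p: "p \<in> Q" "g = fst p \<or> g = snd p"
      by auto
    have "pairs_avoiding {g} Q = Q - {p}"
    proof -
      have P: "p \<in> P" using p(1) by (auto simp: Q pairs_avoiding_def)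
      have "q = p" if q: "q \<in> Q" "g = fst q \<or> g = snd q" for q
      proof -
        have "q \<in> P" using q(1) by (auto simp: Q pairs_avoiding_def)
        moreover have "fst q \<noteq> snd p" "fst p \<noteq> snd q"
          using disj P \<open>q \<in> P\<close> unfolding disjoint_pairs_def by blast+
        ultimately show ?thesis
          using q(2) p(2) P disj unfolding disjoint_pairs_def by (metis inj_onD)
      qed
      with p(2) show ?thesis
        by (cases p) (auto simp: pairs_avoiding_def)
    qed
    moreover have "g \<notin> Z"
      using True by (auto simp: Q pairs_avoiding_def)
    moreover have "card Q > 0"
      using p(1) finQ by (auto simp: card_gt_0_iff)
    ultimately show ?thesis
      using True p finQ by (auto simp: card)
  next
    case False
    then have "pairs_avoiding {g} Q = Q"
      by (force simp: pairs_avoiding_def)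
    with False show ?thesis by (simp add: card)
  qed
qed

lemma card_occupied_gaps:
  assumes "finite P" "disjoint_pairs P" "finite Z" and Q: "Q = pairs_avoiding Z P"
  shows "card (Z \<union> fst ` Q \<union> snd ` Q) = 2 * card Q + card Z"
proof -
  have sub: "Q \<subseteq> P" by (auto simp: Q pairs_avoiding_def)
  then have fin: "finite Q" using assms(1) finite_subset by blast
  have inj: "inj_on fst Q" "inj_on snd Q" and d: "fst ` Q \<inter> snd ` Q = {}"
    using assms(2) sub unfolding disjoint_pairs_def by (auto intro: inj_on_subset)
  have "Z \<inter> (fst ` Q \<union> snd ` Q) = {}"
    by (auto simp: Q pairs_avoiding_def)
  then show ?thesis
    using fin inj d assms(3) by (simp add: Un_assoc card_Un_disjoint card_image)
qed

text \<open>For the four statistics, \<open>Z n\<close> is empty or consists of one boundary gap of a word of length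
  \<open>2 n\<close>, and \<open>w\<close> is the distance between the two gaps of the object formed by a newly inserted pair.\<close>

lemma insertion_law_gap_pairs:
  assumes init: "f [] = 0"
    and f: "\<And>n \<sigma>. \<sigma> \<in> stirling_perms n \<Longrightarrow> f \<sigma> = card (pairs_avoiding (Z n) (P \<sigma>))"
    and range: "\<And>n \<sigma>. \<sigma> \<in> stirling_perms n \<Longrightarrow> P \<sigma> \<subseteq> {..2 * n} \<times> {..2 * n}"
    and disj: "\<And>n \<sigma>. \<sigma> \<in> stirling_perms n \<Longrightarrow> disjoint_pairs (P \<sigma>)"
    and ins: "\<And>n \<sigma> g. \<sigma> \<in> stirling_perms n \<Longrightarrow> g \<le> 2 * n \<Longrightarrow> P (insert_pair (Suc n) g \<sigma>) =
         insert (g, g + w) (map_prod (shift g) (shift g) ` pairs_avoiding {g} (P \<sigma>))"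
    and Z: "\<And>n. Z n \<subseteq> {..2 * n}" "\<And>n. card (Z n) = c"
    and new: "\<And>n g. g \<le> 2 * n \<Longrightarrow> g \<in> Z (Suc n) \<or> g + w \<in> Z (Suc n) \<longleftrightarrow> g \<in> Z n"
    and old: "\<And>n g k. g \<le> 2 * n \<Longrightarrow> k \<le> 2 * n \<Longrightarrow> k \<noteq> g \<Longrightarrow> shift g k \<in> Z (Suc n) \<longleftrightarrow> k \<in> Z n"
  shows "insertion_law c f"
  unfolding insertion_law_def
proof (intro conjI allI ballI)
  fix n \<sigma> assume \<sigma>: "\<sigma> \<in> stirling_perms n"
  define Q where "Q = pairs_avoiding (Z n) (P \<sigma>)"
  define D where "D = Z n \<union> fst ` Q \<union> snd ` Q"
  have fin: "finite (P \<sigma>)" "finite (Z n)"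
    using range[OF \<sigma>] Z(1)[of n] finite_subset by blast+
  have "Q \<subseteq> P \<sigma>"
    by (auto simp: Q_def pairs_avoiding_def)
  then have "D \<subseteq> {..2 * n}"
    using range[OF \<sigma>] Z(1)[of n] unfolding D_def by force
  moreover have "card D = 2 * f \<sigma> + c"
    using card_occupied_gaps[OF fin(1) disj[OF \<sigma>] fin(2) Q_def] f[OF \<sigma>]
    by (simp add: D_def Q_def Z(2))
  moreover have "f (insert_pair (Suc n) g \<sigma>) = (if g \<in> D then f \<sigma> else Suc (f \<sigma>))"
    if g: "g \<le> 2 * n" for g
  proof -
    have "insert_pair (Suc n) g \<sigma> \<in> stirling_perms (Suc n)"
      using insert_pair_in_stirling_perms \<sigma> g length_stirling_perms[OF \<sigma>] by simp
    moreover have "shift g k \<in> Z (Suc n) \<longleftrightarrow> k \<in> Z n"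
      if "(a, b) \<in> P \<sigma>" "k \<in> {a, b}" "k \<noteq> g" for a b k
      using that range[OF \<sigma>] old[OF g, of k] by auto
    ultimately show ?thesis
      using card_pairs_after_insertion[OF fin(1) disj[OF \<sigma>] ins[OF \<sigma> g] new[OF g] _ Q_def] f f[OF \<sigma>]
      by (simp add: D_def Q_def)
  qed
  ultimately show "\<exists>D\<subseteq>{..2 * n}. card D = 2 * f \<sigma> + c \<and>
      (\<forall>g\<le>2 * n. f (insert_pair (Suc n) g \<sigma>) = (if g \<in> D then f \<sigma> else Suc (f \<sigma>)))"
    by blast
qed (rule init)

section \<open>Ascent-plateaux\<close>

text \<open>Every letter read outside the word is 0, so the ascent forces both copies to lie inside the
  word.\<close>

definition plateau_gaps :: "nat list \<Rightarrow> (nat \<times> nat) set" where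
  "plateau_gaps \<sigma> = {(a, b). b = Suc a \<and> letter \<sigma> a < letter \<sigma> (Suc a) \<and>
     letter \<sigma> (Suc a) = letter \<sigma> (Suc (Suc a))}"

lemma plateau_gaps_length: "(a, b) \<in> plateau_gaps \<sigma> \<Longrightarrow> a < length \<sigma> \<and> b < length \<sigma>"
  using letter_pos_imp_le_length[of \<sigma> "Suc (Suc a)"] by (auto simp: plateau_gaps_def)

lemma disjoint_pairs_plateau_gaps: "disjoint_pairs (plateau_gaps \<sigma>)"
  by (auto simp: disjoint_pairs_def plateau_gaps_def inj_on_def)

text \<open>An old plateau survives exactly if the new letters separate neither its ascent nor its two
  copies. The only new plateau starts with the inserted pair: an old letter placed next to a
  new one is smaller than it, so it neither equals it nor rises above it.\<close>

lemma plateau_gaps_insert_pair: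
  assumes g: "g \<le> length \<sigma>" and small: "\<And>k. letter \<sigma> k < m"
  shows "plateau_gaps (insert_pair m g \<sigma>) =
    insert (g, Suc g) (map_prod (shift g) (shift g) ` pairs_avoiding {g} (plateau_gaps \<sigma>))"
    (is "?L = ?R")
proof -
  let ?\<tau> = "insert_pair m g \<sigma>"
  note old = letter_insert_pair_old[OF g] and new = letter_insert_pair_new[OF g]
  have g_old: "letter ?\<tau> g = letter \<sigma> g"
    using old[of m g] by (simp add: shift_def)
  show ?thesis
  proof (intro equalityI subrelI)
    fix a b assume ab: "(a, b) \<in> ?L"
    show "(a, b) \<in> ?R"
    proof (cases a rule: position_cases[of _ g])
      case (old a')
      show ?thesis
      proof (cases "a' = g")
        case True
        then show ?thesis using ab old by (simp add: plateau_gaps_def shift_def)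
      next
        case False
        note 1 = letter_insert_pair_old[OF g, of m a'] letter_insert_pair_old[OF g, of m "Suc a'"]
        have "Suc a' \<noteq> g"
        proof
          assume *: "Suc a' = g"
          then have "letter ?\<tau> (Suc (Suc a)) = m" "letter ?\<tau> (Suc a) = letter \<sigma> g"
            using new g_old old by (auto simp: shift_def)
          then show False using ab small[of g] by (simp add: plateau_gaps_def)
        qed
        then have "(a', Suc a') \<in> pairs_avoiding {g} (plateau_gaps \<sigma>)"
          using ab False 1 letter_insert_pair_old[OF g, of m "Suc (Suc a')"]
          by (simp add: plateau_gaps_def pairs_avoiding_def old shift_Suc)
        then show ?thesis
          using ab False old by (force simp: plateau_gaps_def shift_Suc)
      qed
    qed (use ab new letter_insert_pair_le[OF g less_imp_le[OF small], of "Suc a"] in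
        \<open>auto simp: plateau_gaps_def\<close>)
  next
    fix a b assume "(a, b) \<in> ?R"
    then consider "a = g" "b = Suc g" | a' where "a' \<noteq> g" "Suc a' \<noteq> g" "(a', Suc a') \<in> plateau_gaps \<sigma>"
        "a = shift g a'" "b = shift g (Suc a')"
      by (auto simp: pairs_avoiding_def plateau_gaps_def)
    then show "(a, b) \<in> ?L"
    proof cases
      case 1
      then show ?thesis using new g_old small by (simp add: plateau_gaps_def)
    next
      case 2
      then show ?thesis
        using old[of m a'] old[of m "Suc a'"] old[of m "Suc (Suc a')"]
        by (simp add: plateau_gaps_def shift_Suc)
    qed
  qed
qed

section \<open>Up-down-pairs\<close>

definition updown_gaps :: "nat list \<Rightarrow> (nat \<times> nat) set" where
  "updown_gaps \<sigma> = {(a, b). Suc a < b \<and> letter \<sigma> a < letter \<sigma> (Suc a) \<and>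
     letter \<sigma> (Suc a) = letter \<sigma> b \<and> letter \<sigma> (Suc b) < letter \<sigma> b}"

lemma updown_gaps_length: "(a, b) \<in> updown_gaps \<sigma> \<Longrightarrow> Suc a < b \<and> b \<le> length \<sigma>"
  using letter_pos_imp_le_length[of \<sigma> b] by (auto simp: updown_gaps_def)

text \<open>The first gap of a pair is an ascent of the word and the second one a descent, so only gaps
  of the same kind could coincide; then three equal letters would occur.\<close>

lemma disjoint_pairs_updown_gaps:
  assumes \<sigma>: "\<sigma> \<in> stirling_perms n"
  shows "disjoint_pairs (updown_gaps \<sigma>)"
  unfolding disjoint_pairs_def
proof (intro conjI inj_onI)
  fix p q assume p: "p \<in> updown_gaps \<sigma>" and q: "q \<in> updown_gaps \<sigma>" and eq: "fst p = fst q"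
  have "snd p = snd q"
    by (rule no_three_equal_letters[OF \<sigma>, of "Suc (fst p)"])
      (use p q eq in \<open>auto simp: updown_gaps_def\<close>)
  with eq show "p = q" by (simp add: prod_eq_iff)
next
  fix p q assume p: "p \<in> updown_gaps \<sigma>" and q: "q \<in> updown_gaps \<sigma>" and eq: "snd p = snd q"
  have "Suc (fst p) = Suc (fst q)"
    by (rule no_three_equal_letters[OF \<sigma>, of "snd p"])
      (use p q eq in \<open>auto simp: updown_gaps_def\<close>)
  with eq show "p = q" by (simp add: prod_eq_iff)
qed (auto simp: updown_gaps_def)

text \<open>New letters strictly between the two entries of a pair do no harm; only the letter before
  the first entry and the letter after the second one matter, and a new largest letter is wrong in both
  places. Hence nothing but the two boundary gaps of a pair is sensitive to the insertion. The
  inserted pair is itself an up-down-pair because both its neighbours are smaller, the boundary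
  zeros included.\<close>

lemma updown_gaps_insert_pair:
  assumes g: "g \<le> length \<sigma>" and small: "\<And>k. letter \<sigma> k < m"
  shows "updown_gaps (insert_pair m g \<sigma>) =
    insert (g, Suc (Suc g)) (map_prod (shift g) (shift g) ` pairs_avoiding {g} (updown_gaps \<sigma>))"
    (is "?L = ?R")
proof -
  let ?\<tau> = "insert_pair m g \<sigma>"
  note old = letter_insert_pair_old[OF g] and new = letter_insert_pair_new[OF g]
  have g_old: "letter ?\<tau> g = letter \<sigma> g"
    using old[of m g] by (simp add: shift_def)
  have g_old': "letter ?\<tau> (Suc (Suc (Suc g))) = letter \<sigma> (Suc g)"
    using old[of m "Suc g"] by (simp add: shift_def)
  have le: "letter ?\<tau> k \<le> m" for k
    by (rule letter_insert_pair_le[OF g less_imp_le[OF small]])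
  show ?thesis
  proof (intro equalityI subrelI)
    fix a b assume "(a, b) \<in> ?L"
    then have ab: "Suc a < b" "letter ?\<tau> a < letter ?\<tau> (Suc a)"
        "letter ?\<tau> (Suc a) = letter ?\<tau> b" "letter ?\<tau> (Suc b) < letter ?\<tau> b"
      by (auto simp: updown_gaps_def)
    have "letter ?\<tau> a < m"
      using ab(2) le[of "Suc a"] by simp
    then obtain a' where a: "a = shift g a'"
      using new by (cases a rule: position_cases[of _ g]) auto
    show "(a, b) \<in> ?R"
    proof (cases "a' = g")
      case True
      then have "a = g" by (simp add: a shift_def)
      with ab new have "letter ?\<tau> b = m" by simp
      with small old have "b = Suc g \<or> b = Suc (Suc g)"
        by (cases b rule: position_cases[of _ g]) (auto dest: less_imp_neq)
      with ab \<open>a = g\<close> show ?thesis by simp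
    next
      case False
      then have Suc_a: "Suc a = shift g (Suc a')"
        by (simp add: a shift_Suc)
      then have "letter ?\<tau> b < m"
        using ab(3) old[of m "Suc a'"] small[of "Suc a'"] by simp
      then obtain b' where b: "b = shift g b'"
        using new by (cases b rule: position_cases[of _ g]) auto
      have "b' \<noteq> g"
      proof
        assume "b' = g"
        then have "letter ?\<tau> (Suc b) = m"
          using new by (simp add: b shift_def)
        with ab(4) le[of b] show False by simp
      qed
      then have "Suc b = shift g (Suc b')"
        by (simp add: b shift_Suc)
      then have "(a', b') \<in> pairs_avoiding {g} (updown_gaps \<sigma>)"
        using ab False \<open>b' \<noteq> g\<close> unfolding Suc_a
        by (simp add: a b old updown_gaps_def pairs_avoiding_def)
      then show ?thesis
        by (auto simp: a b)
    qed
  next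
    fix a b assume "(a, b) \<in> ?R"
    then consider "a = g" "b = Suc (Suc g)"
      | a' b' where "a' \<noteq> g" "b' \<noteq> g" "(a', b') \<in> updown_gaps \<sigma>" "a = shift g a'" "b = shift g b'"
      by (auto simp: pairs_avoiding_def)
    then show "(a, b) \<in> ?L"
    proof cases
      case 1
      then show ?thesis using new g_old g_old' small by (simp add: updown_gaps_def)
    next
      case 2
      then have "Suc a = shift g (Suc a')" "Suc b = shift g (Suc b')"
        by (simp_all add: shift_Suc)
      with 2 show ?thesis
        by (simp add: updown_gaps_def old)
    qed
  qed
qed

section \<open>The four statistics\<close>

text \<open>An object is determined by its first gap, whose successor is the position that the
  statistics count.\<close>

lemma card_eq_card_gap_pairs:
  assumes "disjoint_pairs P" "\<And>i. i \<in> I \<longleftrightarrow> (\<exists>a b. i = Suc a \<and> (a, b) \<in> pairs_avoiding Z P)"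
  shows "card I = card (pairs_avoiding Z P)"
proof -
  have "pairs_avoiding Z P \<subseteq> P"
    by (auto simp: pairs_avoiding_def)
  then have "inj_on fst (pairs_avoiding Z P)"
    using assms(1) inj_on_subset unfolding disjoint_pairs_def by blast
  then have "inj_on (Suc \<circ> fst) (pairs_avoiding Z P)"
    by (simp add: comp_inj_on)
  moreover have "I = (Suc \<circ> fst) ` pairs_avoiding Z P"
    by (rule set_eqI, unfold assms(2) image_iff) force
  ultimately show ?thesis
    by (simp only: card_image)
qed

lemma lap_conv_gaps: "lap \<sigma> = card (pairs_avoiding {} (plateau_gaps \<sigma>))"
  unfolding lap_def
proof (rule card_eq_card_gap_pairs[OF disjoint_pairs_plateau_gaps])
  fix i
  show "i \<in> {i \<in> {1..length \<sigma> - 1}. letter \<sigma> (i - 1) < letter \<sigma> i \<and> letter \<sigma> i = letter \<sigma> (i + 1)}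
      \<longleftrightarrow> (\<exists>a b. i = Suc a \<and> (a, b) \<in> pairs_avoiding {} (plateau_gaps \<sigma>))"
    using plateau_gaps_length[of "i - 1" i \<sigma>]
    by (cases i) (auto simp: pairs_avoiding_def plateau_gaps_def)
qed

text \<open>The plateau that \<open>lap\<close> counts and \<open>ap\<close> omits is an initial one; its ascent is the
  leftmost gap.\<close>

lemma ap_conv_gaps: "ap \<sigma> = card (pairs_avoiding {0} (plateau_gaps \<sigma>))"
  unfolding ap_def
proof (rule card_eq_card_gap_pairs[OF disjoint_pairs_plateau_gaps])
  fix i
  show "i \<in> {i \<in> {2..length \<sigma> - 1}. letter \<sigma> (i - 1) < letter \<sigma> i \<and> letter \<sigma> i = letter \<sigma> (i + 1)}
      \<longleftrightarrow> (\<exists>a b. i = Suc a \<and> (a, b) \<in> pairs_avoiding {0} (plateau_gaps \<sigma>))"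
    using plateau_gaps_length[of "i - 1" i \<sigma>]
    by (cases i) (auto simp: pairs_avoiding_def plateau_gaps_def)
qed

lemma up_down_pair_entry_iff_gaps:
  "i \<in> {1..m - 1} \<and> up_down_pair_entry \<sigma> m i \<longleftrightarrow>
    (\<exists>a b. i = Suc a \<and> (a, b) \<in> updown_gaps \<sigma> \<and> b \<le> m)"
proof
  assume i: "i \<in> {1..m - 1} \<and> up_down_pair_entry \<sigma> m i"
  then obtain a where "i = Suc a" by (cases i) auto
  with i show "\<exists>a b. i = Suc a \<and> (a, b) \<in> updown_gaps \<sigma> \<and> b \<le> m"
    unfolding up_down_pair_entry_def updown_gaps_def by auto
next
  assume "\<exists>a b. i = Suc a \<and> (a, b) \<in> updown_gaps \<sigma> \<and> b \<le> m"
  then obtain a b where "i = Suc a" "(a, b) \<in> updown_gaps \<sigma>" "b \<le> m"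
    by blast
  then show "i \<in> {1..m - 1} \<and> up_down_pair_entry \<sigma> m i"
    unfolding up_down_pair_entry_def updown_gaps_def by auto
qed

lemma eud_conv_gaps:
  assumes \<sigma>: "\<sigma> \<in> stirling_perms n"
  shows "eud \<sigma> = card (pairs_avoiding {} (updown_gaps \<sigma>))"
  unfolding eud_def
proof (rule card_eq_card_gap_pairs[OF disjoint_pairs_updown_gaps[OF \<sigma>]])
  fix i
  show "i \<in> {i \<in> {1..length \<sigma> - 1}. up_down_pair_entry \<sigma> (length \<sigma>) i}
      \<longleftrightarrow> (\<exists>a b. i = Suc a \<and> (a, b) \<in> pairs_avoiding {} (updown_gaps \<sigma>))"
    unfolding mem_Collect_eq up_down_pair_entry_iff_gaps pairs_avoiding_def
    by (auto dest: updown_gaps_length)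
qed

text \<open>The pair that \<open>eud\<close> counts and \<open>ud\<close> omits ends at the last letter, and the gap after it
  is the rightmost one.\<close>

lemma ud_conv_gaps:
  assumes \<sigma>: "\<sigma> \<in> stirling_perms n"
  shows "ud \<sigma> = card (pairs_avoiding {2 * n} (updown_gaps \<sigma>))"
  unfolding ud_def
proof (rule card_eq_card_gap_pairs[OF disjoint_pairs_updown_gaps[OF \<sigma>]])
  fix i
  have "b \<le> length \<sigma> - 1 \<longleftrightarrow> a \<noteq> 2 * n \<and> b \<noteq> 2 * n" if "(a, b) \<in> updown_gaps \<sigma>" for a b
    using updown_gaps_length[OF that] length_stirling_perms[OF \<sigma>] by auto
  moreover have "i \<in> {1..length \<sigma> - 2} \<and> up_down_pair_entry \<sigma> (length \<sigma> - 1) i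
      \<longleftrightarrow> (\<exists>a b. i = Suc a \<and> (a, b) \<in> updown_gaps \<sigma> \<and> b \<le> length \<sigma> - 1)"
    using up_down_pair_entry_iff_gaps[of i "length \<sigma> - 1" \<sigma>] by (simp add: numeral_2_eq_2)
  ultimately show "i \<in> {i \<in> {1..length \<sigma> - 2}. up_down_pair_entry \<sigma> (length \<sigma> - 1) i}
      \<longleftrightarrow> (\<exists>a b. i = Suc a \<and> (a, b) \<in> pairs_avoiding {2 * n} (updown_gaps \<sigma>))"
    unfolding mem_Collect_eq pairs_avoiding_def by blast
qed

lemma plateau_gaps_insert_stirling:
  assumes "\<sigma> \<in> stirling_perms n" "g \<le> 2 * n"
  shows "plateau_gaps (insert_pair (Suc n) g \<sigma>) =
    insert (g, g + 1) (map_prod (shift g) (shift g) ` pairs_avoiding {g} (plateau_gaps \<sigma>))"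
  using plateau_gaps_insert_pair[of g \<sigma> "Suc n"] assms letter_stirling_perm_le[OF assms(1)]
  by (simp add: length_stirling_perms less_Suc_eq_le)

lemma updown_gaps_insert_stirling:
  assumes "\<sigma> \<in> stirling_perms n" "g \<le> 2 * n"
  shows "updown_gaps (insert_pair (Suc n) g \<sigma>) =
    insert (g, g + 2) (map_prod (shift g) (shift g) ` pairs_avoiding {g} (updown_gaps \<sigma>))"
  using updown_gaps_insert_pair[of g \<sigma> "Suc n"] assms letter_stirling_perm_le[OF assms(1)]
  by (simp add: length_stirling_perms less_Suc_eq_le)

lemma plateau_gaps_range: "\<sigma> \<in> stirling_perms n \<Longrightarrow> plateau_gaps \<sigma> \<subseteq> {..2 * n} \<times> {..2 * n}"
  by (auto dest!: plateau_gaps_length simp: length_stirling_perms)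

lemma updown_gaps_range: "\<sigma> \<in> stirling_perms n \<Longrightarrow> updown_gaps \<sigma> \<subseteq> {..2 * n} \<times> {..2 * n}"
  by (auto dest!: updown_gaps_length simp: length_stirling_perms)

lemma insertion_law_lap: "insertion_law 0 lap"
proof (rule insertion_law_gap_pairs[where P = plateau_gaps and Z = "\<lambda>_. {}" and w = 1])
  show "lap [] = 0"
    by (simp add: lap_def)
qed (auto simp: lap_conv_gaps plateau_gaps_insert_stirling disjoint_pairs_plateau_gaps shift_def
    plateau_gaps_range)

lemma insertion_law_ap: "insertion_law 1 ap"
proof (rule insertion_law_gap_pairs[where P = plateau_gaps and Z = "\<lambda>_. {0}" and w = 1])
  show "ap [] = 0"
    by (simp add: ap_def)
qed (auto simp: ap_conv_gaps plateau_gaps_insert_stirling disjoint_pairs_plateau_gaps shift_def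
    plateau_gaps_range)

lemma insertion_law_eud: "insertion_law 0 eud"
proof (rule insertion_law_gap_pairs[where P = updown_gaps and Z = "\<lambda>_. {}" and w = 2])
  show "eud [] = 0"
    by (simp add: eud_def)
qed (auto simp: eud_conv_gaps updown_gaps_insert_stirling disjoint_pairs_updown_gaps shift_def
    updown_gaps_range)

lemma insertion_law_ud: "insertion_law 1 ud"
proof (rule insertion_law_gap_pairs[where P = updown_gaps and Z = "\<lambda>n. {2 * n}" and w = 2])
  show "ud [] = 0"
    by (simp add: ud_def)
qed (auto simp: ud_conv_gaps updown_gaps_insert_stirling disjoint_pairs_updown_gaps shift_def
    updown_gaps_range)

theorem theorem7:
  fixes n :: nat
  assumes "n \<ge> 1"
  shows "(\<Sum>\<sigma>\<in>stirling_perms n. [:0, 1 :: int:] ^ ap \<sigma>) = (\<Sum>\<sigma>\<in>stirling_perms n. [:0, 1:] ^ ud \<sigma>)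
       \<and> (\<Sum>\<sigma>\<in>stirling_perms n. [:0, 1 :: int:] ^ lap \<sigma>) = (\<Sum>\<sigma>\<in>stirling_perms n. [:0, 1:] ^ eud \<sigma>)"
  by (intro conjI insertion_law_equidistributed[OF insertion_law_ap insertion_law_ud]
      insertion_law_equidistributed[OF insertion_law_lap insertion_law_eud])

end
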